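(* If $H$ is a layered graph (resp. an induced layered graph), then there is a sufficiently large $N$ such that every $2$-coloring of the vertices of $K_3^{\square N}$ contains a monochromatic copy (resp. induced copy) of $H$.
   Context: $K_3^{\square N}$ is the $N$-th Cartesian power of the triangle $K_3$; equivalently, its vertex set is $[3]^N$ and two vertices are adjacent iff they differ in exactly one coordinate. The hypercube $Q_d$ has vertex set $\{0,1\}^d$ with two vertices adjacent iff they differ in exactly one coordinate; its $k$-th vertex layer is the set of vertices with exactly $k$ ones, and its $k$-th edge layer is the subgraph induced by the $k$-th and $(k-1)$-th vertex layers. A graph is (induced) layered if it is an (induced) subgraph of an edge layer of some hypercube. *)

theory Defs
  imports "Graph_Theory.Graph_Theory" "HOL-Library.FuncSet"
begin

text \<open>
  Graphs are taken from the library \<^theory>\<open>Graph_Theory.Graph_Theory\<close>: a finite simple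
  undirected graph is a \<^const>\<open>graph\<close>, i.e. a finite symmetric digraph without loops and
  parallel arcs, each edge being represented by its two opposite arcs.
\<close>

definition hamming_graph :: "'a set \<Rightarrow> nat \<Rightarrow> (nat \<Rightarrow> 'a) pair_pre_digraph" where
  "hamming_graph A n = \<lparr>
     pverts = {..<n} \<rightarrow>\<^sub>E A,
     parcs = {(x, y). x \<in> {..<n} \<rightarrow>\<^sub>E A \<and> y \<in> {..<n} \<rightarrow>\<^sub>E A \<and>
                      card {i \<in> {..<n}. x i \<noteq> y i} = 1} \<rparr>"

definition K3_power :: "nat \<Rightarrow> (nat \<Rightarrow> nat) pair_pre_digraph" where
  "K3_power N = hamming_graph {1, 2, 3} N"

definition hypercube :: "nat \<Rightarrow> (nat \<Rightarrow> nat) pair_pre_digraph" where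
  "hypercube d = hamming_graph {0, 1} d"

definition vertex_layer :: "nat \<Rightarrow> nat \<Rightarrow> (nat \<Rightarrow> nat) set" where
  "vertex_layer d k = {x \<in> pverts (hypercube d). card {i \<in> {..<d}. x i = 1} = k}"

text \<open>Meant for \<open>1 \<le> k \<le> d\<close> only.\<close>

definition edge_layer ::
    "nat \<Rightarrow> nat \<Rightarrow> (nat \<Rightarrow> nat, (nat \<Rightarrow> nat) \<times> (nat \<Rightarrow> nat)) pre_digraph" where
  "edge_layer d k = hypercube d \<restriction> (vertex_layer d k \<union> vertex_layer d (k - 1))"

text \<open>
  A subgraph in the sense of \<^const>\<open>subgraph\<close> need not be symmetric, but a copy of a symmetric
  graph always is, so for a \<^const>\<open>graph\<close> \<open>H\<close> these are copies in the undirected sense.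
\<close>

definition copy_in :: "('a, 'b) pre_digraph \<Rightarrow> ('c, 'd) pre_digraph \<Rightarrow> ('c, 'd) pre_digraph \<Rightarrow> bool" where
  "copy_in H G S \<longleftrightarrow> subgraph S G \<and> digraph_iso H S"

definition induced_copy_in :: "('a, 'b) pre_digraph \<Rightarrow> ('c, 'd) pre_digraph \<Rightarrow> ('c, 'd) pre_digraph \<Rightarrow> bool" where
  "induced_copy_in H G S \<longleftrightarrow> induced_subgraph S G \<and> digraph_iso H S"

definition layered :: "('a, 'b) pre_digraph \<Rightarrow> bool" where
  "layered H \<longleftrightarrow> (\<exists>d. \<exists>k\<in>{1..d}. \<exists>S. copy_in H (edge_layer d k) S)"

definition induced_layered :: "('a, 'b) pre_digraph \<Rightarrow> bool" where
  "induced_layered H \<longleftrightarrow> (\<exists>d. \<exists>k\<in>{1..d}. \<exists>S. induced_copy_in H (edge_layer d k) S)"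

definition monochromatic :: "('c \<Rightarrow> nat) \<Rightarrow> ('c, 'd) pre_digraph \<Rightarrow> bool" where
  "monochromatic c S \<longleftrightarrow> (\<exists>a. \<forall>v\<in>verts S. c v = a)"

lemma pair_graph_hamming_graph:
  assumes "finite A"
  shows "pair_graph (hamming_graph A n)"
proof -
  have "parcs (hamming_graph A n) \<subseteq> ({..<n} \<rightarrow>\<^sub>E A) \<times> ({..<n} \<rightarrow>\<^sub>E A)"
    by (auto simp: hamming_graph_def)
  moreover have fin: "finite ({..<n} \<rightarrow>\<^sub>E A)"
    using assms by (intro finite_PiE) auto
  ultimately have "finite (parcs (hamming_graph A n))"
    by (meson finite_SigmaI finite_subset)
  moreover have "card {i. i < n \<and> y i \<noteq> x i} = Suc 0"
    if "card {i. i < n \<and> x i \<noteq> y i} = Suc 0" for x y :: "nat \<Rightarrow> 'a"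
  proof -
    have "{i. i < n \<and> y i \<noteq> x i} = {i. i < n \<and> x i \<noteq> y i}"
      by auto
    with that show ?thesis by simp
  qed
  ultimately show ?thesis
    using fin by unfold_locales (auto simp: hamming_graph_def symmetric_def sym_def)
qed

end

theory Submission
  imports "HOL-Library.Ramsey" Defs
begin

text \<open>
  By Ramsey's theorem for hypergraphs we may restrict to a set of coordinates (all others being
  fixed to 3) on which the colour of a point depends only on the word over \<open>{1, 2}\<close> left after
  deleting its 3s. If lengthening some run \<open>a\<^sup>k\<close> to \<open>a\<^sup>k\<^sup>+\<^sup>1\<close> inside some
  word \<open>u a\<^sup>k v\<close> preserves the colour, then the points reading \<open>u\<close>, then \<open>k\<close> or \<open>k + 1\<close> letters
  \<open>a\<close> scattered among 3s, then \<open>v\<close>, form a monochromatic edge layer. Otherwise lengthening a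
  run always switches the colour; as \<open>1\<^sup>k 1 2\<^sup>k\<close> and \<open>1\<^sup>k 2 2\<^sup>k\<close> both lengthen a run
  of \<open>1\<^sup>k 2\<^sup>k\<close>, they are interchangeable, and concatenating \<open>d\<close> such blocks yields a whole
  monochromatic cube \<open>Q\<^sub>d\<close>. Both embeddings are isometric, so induced copies stay induced.
\<close>

hide_const (open) Ramsey.monochromatic

section \<open>Transporting copies along embeddings\<close>

text \<open>The copy is pushed forward along \<open>F\<close>. The equivalence \<open>arcs\<close>
  is used from left to right to land inside \<open>G'\<close>, and from right to left only to keep
  an induced copy induced. Knowing \<open>verts S'\<close> lets the colour of the new copy be read
  off later.\<close>

lemma copy_in_transport:
  fixes F :: "'v \<Rightarrow> 'w"
  assumes wf: "pair_wf_digraph G'"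
    and proj: "tail G = fst" "head G = snd"
    and verts: "\<And>x. x \<in> verts G \<Longrightarrow> F x \<in> pverts G'"
    and inj: "inj_on F (verts G)"
    and arcs: "\<And>x y. x \<in> verts G \<Longrightarrow> y \<in> verts G \<Longrightarrow> (x, y) \<in> arcs G \<longleftrightarrow> (F x, F y) \<in> parcs G'"
    and copy: "copy_in H G S"
  shows "\<exists>S'. copy_in H (with_proj G') S' \<and> verts S' = F ` verts S \<and>
           (induced_copy_in H G S \<longrightarrow> induced_copy_in H (with_proj G') S')"
proof -
  \<comment> \<open>Arcs of \<open>S\<close> are ordered pairs of vertices, so the arc map has to be
    \<open>map_prod F F\<close>.\<close>
  define hom where "hom = \<lparr>iso_verts = F, iso_arcs = map_prod F F, iso_head = snd, iso_tail = fst\<rparr>"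
  define S' where "S' = app_iso hom S"
  have sub: "subgraph S G" and iso: "digraph_iso H S"
    using copy by (auto simp: copy_in_def)
  have VS: "verts S \<subseteq> verts G" and AS: "arcs S \<subseteq> arcs G" and wfS: "wf_digraph S"
    and projS: "tail S = fst" "head S = snd"
    using sub proj by (auto simp: subgraph_def compatible_def)
  have ends: "x \<in> verts S \<and> y \<in> verts S" if "(x, y) \<in> arcs S" for x y
    using wf_digraph.tail_in_verts[OF wfS that] wf_digraph.head_in_verts[OF wfS that] projS by auto
  have "inj_on (map_prod F F) (verts G \<times> verts G)"
    by (rule map_prod_inj_on[OF inj inj])
  then have "inj_on (map_prod F F) (arcs S)"
    by (rule inj_on_subset) (use ends VS in auto)
  then have hom: "pre_digraph.digraph_isomorphism S hom"
    using wfS inj_on_subset[OF inj VS] projS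
    by (auto simp: pre_digraph.digraph_isomorphism_def hom_def)
  then have "digraph_iso S S'"
    by (auto simp: digraph_iso_def S'_def)
  with iso have isoS': "digraph_iso H S'"
    by (rule digraph_iso_trans)
  have vS': "verts S' = F ` verts S"
    and aS': "arcs S' = map_prod F F ` arcs S"
    and pS': "tail S' = fst" "head S' = snd"
    by (auto simp: S'_def hom_def)
  have wfS': "wf_digraph S'"
    using wf_digraph.wf_digraphI_app_iso[OF wfS hom] by (simp add: S'_def)
  have wfG': "wf_digraph (with_proj G')"
    using wf by (simp add: wf_digraph_wp_iff)
  have subS': "subgraph S' (with_proj G')"
    unfolding subgraph_def compatible_def
  proof (intro conjI)
    show "verts S' \<subseteq> verts (with_proj G')"
      using vS' VS verts by auto
    show "arcs S' \<subseteq> arcs (with_proj G')"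
    proof
      fix e assume "e \<in> arcs S'"
      then obtain x y where "(x, y) \<in> arcs S" "e = (F x, F y)"
        using aS' by auto
      then show "e \<in> arcs (with_proj G')"
        using arcs[of x y] ends[of x y] VS AS by auto
    qed
  qed (use pS' wfS' wfG' in simp_all)
  have "induced_copy_in H (with_proj G') S'" if ind: "induced_copy_in H G S"
  proof -
    have aS: "arcs S = {e \<in> arcs G. fst e \<in> verts S \<and> snd e \<in> verts S}"
      using ind proj by (auto simp: induced_copy_in_def induced_subgraph_def)
    have "e \<in> arcs S'" if e: "e \<in> parcs G'" "fst e \<in> verts S'" "snd e \<in> verts S'" for e
    proof -
      obtain x y where xy: "x \<in> verts S" "y \<in> verts S" "e = (F x, F y)"
        using e vS' by (cases e) auto
      then have "(x, y) \<in> arcs S"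
        using arcs[of x y] e VS aS by auto
      then show ?thesis
        using xy aS' by force
    qed
    moreover have "e \<in> parcs G' \<and> fst e \<in> verts S' \<and> snd e \<in> verts S'" if "e \<in> arcs S'" for e
      using that subS' wf_digraph.tail_in_verts[OF wfS' that] wf_digraph.head_in_verts[OF wfS' that] pS'
      by (auto simp: subgraph_def)
    ultimately show ?thesis
      using subS' isoS' by (auto simp: induced_copy_in_def induced_subgraph_def)
  qed
  then show ?thesis
    using subS' isoS' vS' by (auto simp: copy_in_def)
qed


section \<open>Hamming distance of lists\<close>

definition list_dist :: "'a list \<Rightarrow> 'a list \<Rightarrow> nat" where
  "list_dist s t = length (filter (\<lambda>(a, b). a \<noteq> b) (zip s t))"

lemma list_dist_append:
  "length s = length t \<Longrightarrow> list_dist (s @ s') (t @ t') = list_dist s t + list_dist s' t'"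
  by (simp add: list_dist_def)

lemma list_dist_same [simp]: "list_dist s s = 0"
  by (auto simp: list_dist_def zip_same_conv_map filter_empty_conv)

lemma list_dist_map: "list_dist (map f is) (map g is) = length (filter (\<lambda>i. f i \<noteq> g i) is)"
  by (induction "is") (auto simp: list_dist_def)

lemma list_dist_concat_map:
  assumes "\<And>i. i \<in> set is \<Longrightarrow> length (f i) = length (g i)"
  shows "list_dist (concat (map f is)) (concat (map g is)) = (\<Sum>i\<leftarrow>is. list_dist (f i) (g i))"
  using assms by (induction "is") (auto simp: list_dist_append)

lemma length_filter_upt: "length (filter P [0..<d]) = card {i \<in> {..<d}. P i}"
proof -
  have "length (filter P [0..<d]) = card (set (filter P [0..<d]))"
    by (rule distinct_card[symmetric]) simp
  also have "set (filter P [0..<d]) = {i \<in> {..<d}. P i}"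
    by auto
  finally show ?thesis .
qed

lemma list_dist_conv_card:
  assumes "length s = length t"
  shows "list_dist s t = card {i. i < length s \<and> s ! i \<noteq> t ! i}"
  using assms by (auto simp: list_dist_def length_filter_conv_card intro!: arg_cong[of _ _ card])


section \<open>Placing words on coordinates\<close>

text \<open>Coordinates not reached by the word, in particular all those outside \<open>ys\<close>, get the letter 3.\<close>

definition place :: "nat \<Rightarrow> nat list \<Rightarrow> nat list \<Rightarrow> nat \<Rightarrow> nat" where
  "place N ys s = (\<lambda>j\<in>{..<N}. case map_of (zip ys s) j of None \<Rightarrow> 3 | Some a \<Rightarrow> a)"

lemma place_in_K3_power:
  assumes "set s \<subseteq> {1, 2, 3}"
  shows "place N ys s \<in> pverts (K3_power N)"
  using assms
  by (auto simp: place_def K3_power_def hamming_graph_def split: option.splits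
      dest!: map_of_SomeD set_zip_rightD)

text \<open>Off \<open>ys\<close> both points carry the letter 3, and along \<open>ys\<close> they
  spell \<open>s\<close> and \<open>t\<close>, so \<open>(!) ys\<close> maps the positions where the
  words differ bijectively onto the coordinates where the points differ.\<close>

lemma card_place_diff:
  assumes "distinct ys" "set ys \<subseteq> {..<N}" "length s = length ys" "length t = length ys"
  shows "card {j \<in> {..<N}. place N ys s j \<noteq> place N ys t j} = list_dist s t"
proof -
  have nth: "place N ys r (ys ! i) = r ! i" if "i < length ys" "length r = length ys" for r i
  proof -
    have "ys ! i < N"
      using assms(2) nth_mem[OF that(1)] by auto
    then show ?thesis
      using that assms(1) by (simp add: place_def map_of_zip_nth)
  qed
  have out: "place N ys s j = place N ys t j" if "j \<notin> set ys" for j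
  proof -
    have "map_of (zip ys r) j = None" for r :: "nat list"
      using that by (auto simp: map_of_eq_None_iff dest: set_zip_leftD)
    then show ?thesis
      by (simp add: place_def)
  qed
  have "{j \<in> {..<N}. place N ys s j \<noteq> place N ys t j} =
      (!) ys ` {i. i < length s \<and> s ! i \<noteq> t ! i}" (is "?A = ?B")
  proof
    show "?A \<subseteq> ?B"
    proof
      fix j assume j: "j \<in> ?A"
      then have "j \<in> set ys" using out by blast
      then obtain i where "i < length ys" "j = ys ! i"
        by (metis in_set_conv_nth)
      with j show "j \<in> ?B" using nth assms by auto
    qed
    show "?B \<subseteq> ?A"
      using nth assms nth_mem by fastforce
  qed
  moreover have "inj_on ((!) ys) {i. i < length s \<and> s ! i \<noteq> t ! i}"
    using assms by (auto simp: inj_on_def nth_eq_iff_index_eq)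
  ultimately show ?thesis
    using assms by (simp add: card_image list_dist_conv_card)
qed

text \<open>With distinct keys, deleting a pair cannot uncover a later pair with the same key, so a
  key whose pair had the value \<open>z\<close> falls through to the default
  \<open>z\<close>.\<close>

lemma case_map_of_filter:
  assumes "distinct (map fst ps)"
  shows "(case map_of (filter (\<lambda>p. snd p \<noteq> z) ps) j of None \<Rightarrow> z | Some a \<Rightarrow> a) =
         (case map_of ps j of None \<Rightarrow> z | Some a \<Rightarrow> a)"
  using assms
proof (induction ps)
  case (Cons p ps)
  have "map_of (filter (\<lambda>p. snd p \<noteq> z) ps) (fst p) = None"
    using Cons.prems by (auto simp: map_of_eq_None_iff)
  moreover have "map_of ps (fst p) = None"
    using Cons.prems by (auto simp: map_of_eq_None_iff)
  ultimately show ?case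
    using Cons by (cases "j = fst p") auto
qed simp

text \<open>The letter 3 is also the default of \<open>place\<close>, so erasing the 3s together
  with their coordinates changes nothing. The shortened word does not reach \<open>zs\<close>, which
  can therefore be any padding.\<close>

lemma place_filter:
  assumes "distinct ys" "length s = length ys"
  defines "qs \<equiv> filter (\<lambda>p. snd p \<noteq> 3) (zip ys s)"
  shows "place N (map fst qs @ zs) (filter (\<lambda>a. a \<noteq> 3) s) = place N ys s"
proof -
  have "filter (\<lambda>a. a \<noteq> 3) s = map snd qs"
    using assms(2) unfolding qs_def
    by (metis (no_types, lifting) comp_apply filter_cong filter_map map_snd_zip)
  moreover have "zip (map fst qs @ zs) (map snd qs) = qs"
    by (simp add: zip_append1 zip_map_fst_snd)
  moreover have "distinct (map fst (zip ys s))"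
    using assms by simp
  ultimately show ?thesis
    using case_map_of_filter[of "zip ys s" 3] by (simp add: place_def qs_def)
qed


section \<open>Colourings that depend only on the word\<close>

text \<open>\<open>ramsey_full\<close> has numbers as colours; a bijection \<open>h\<close> carries
  it over to any finite set. This is needed because the colours below are functions.\<close>

lemma ramsey_finite_colours:
  assumes "finite C"
  shows "\<exists>N::nat. \<forall>g \<in> nsets {..<N} M \<rightarrow> C. \<exists>Y \<in> nsets {..<N} q. \<exists>a\<in>C. \<forall>S \<in> nsets Y M. g S = a"
proof -
  obtain h where h: "bij_betw h C {0..<card C}"
    using ex_bij_betw_finite_nat[OF assms] by blast
  obtain N :: nat where N: "partn_lst {..<N} (replicate (card C) q) M"
    using ramsey_full by blast
  show ?thesis
  proof (intro exI[of _ N] ballI)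
    fix g assume g: "g \<in> nsets {..<N} M \<rightarrow> C"
    then have "h \<circ> g \<in> nsets {..<N} M \<rightarrow> {..<card C}"
      using bij_betwE[OF h] by fastforce
    then obtain i Y where i: "i < card C" and Y: "Y \<in> nsets {..<N} q"
        and im: "(h \<circ> g) ` nsets Y M \<subseteq> {i}"
      using N by (fastforce simp: partn_lst_def Ramsey.monochromatic_def)
    obtain a where a: "a \<in> C" "h a = i"
      using h i by (metis atLeast0LessThan bij_betw_iff_bijections lessThan_iff)
    have "g S = a" if S: "S \<in> nsets Y M" for S
    proof -
      have "S \<in> nsets {..<N} M"
        using S Y by (auto simp: nsets_def)
      then have "g S \<in> C" using g by blast
      moreover have "h (g S) = h a"
        using im S a by auto
      ultimately show ?thesis
        using h a by (meson bij_betw_def inj_onD)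
    qed
    with Y a show "\<exists>Y \<in> nsets {..<N} q. \<exists>a\<in>C. \<forall>S \<in> nsets Y M. g S = a"
      by blast
  qed
qed

text \<open>Ramsey's theorem is applied to \<open>M\<close>-sets of coordinates, each coloured by
  the whole table of colours that \<open>c\<close> gives to the words from \<open>W\<close> placed
  on it. The homogeneous set yields \<open>Z\<close> working coordinates \<open>ys\<close> and
  \<open>M\<close> spare ones.\<close>

lemma ex_word_colouring:
  fixes M Z :: nat
  shows "\<exists>N. \<forall>c \<in> pverts (K3_power N) \<rightarrow> {1, 2::nat}. \<exists>ys \<chi>.
    distinct ys \<and> length ys = Z \<and> set ys \<subseteq> {..<N} \<and>
    (\<forall>w. set w \<subseteq> {1, 2} \<longrightarrow> length w \<le> M \<longrightarrow> \<chi> w \<in> {1, 2}) \<and>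
    (\<forall>s. set s \<subseteq> {1, 2, 3} \<longrightarrow> length s = Z \<longrightarrow> length (filter (\<lambda>a. a \<noteq> 3) s) \<le> M \<longrightarrow>
       c (place N ys s) = \<chi> (filter (\<lambda>a. a \<noteq> 3) s))"
proof -
  define W where "W = {w. set w \<subseteq> {1, 2::nat} \<and> length w \<le> M}"
  have "finite W"
    unfolding W_def by (rule finite_lists_length_le) simp
  then have "finite (W \<rightarrow>\<^sub>E {1, 2::nat})"
    by (intro finite_PiE) auto
  from ramsey_finite_colours[OF this, of M "Z + M"] obtain N :: nat where
    N: "\<And>g. g \<in> nsets {..<N} M \<rightarrow> (W \<rightarrow>\<^sub>E {1, 2::nat}) \<Longrightarrow>
      \<exists>Y \<in> nsets {..<N} (Z + M). \<exists>a \<in> W \<rightarrow>\<^sub>E {1, 2}. \<forall>S \<in> nsets Y M. g S = a"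
    by blast
  show ?thesis
  proof (intro exI[of _ N] ballI)
    fix c assume c: "c \<in> pverts (K3_power N) \<rightarrow> {1, 2::nat}"
    \<comment> \<open>The set is read in increasing order; a word shorter than \<open>M\<close>
      occupies only its first coordinates.\<close>
    define g where "g S = (\<lambda>w\<in>W. c (place N (sorted_list_of_set S) w))" for S
    have g: "g S \<in> W \<rightarrow>\<^sub>E {1, 2}" for S
    proof (unfold g_def, rule restrict_PiE_iff[THEN iffD2], intro ballI)
      fix w assume "w \<in> W"
      then have "place N (sorted_list_of_set S) w \<in> pverts (K3_power N)"
        by (intro place_in_K3_power) (auto simp: W_def)
      then show "c (place N (sorted_list_of_set S) w) \<in> {1, 2}"
        using c by blast
    qed
    obtain Y \<chi> where Y: "Y \<in> nsets {..<N} (Z + M)" and \<chi>: "\<chi> \<in> W \<rightarrow>\<^sub>E {1, 2::nat}"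
        and hom: "\<And>S. S \<in> nsets Y M \<Longrightarrow> g S = \<chi>"
      using N[of g, OF Pi_I[OF g]] by auto
    define l where "l = sorted_list_of_set Y"
    have l: "sorted_wrt (<) l" "set l = Y" "length l = Z + M" "Y \<subseteq> {..<N}"
      using Y by (auto simp: l_def nsets_def)
    \<comment> \<open>The spare coordinates \<open>drop Z l\<close> lie to the right of all of
      \<open>ys\<close>, so appending some of them preserves the increasing order.\<close>
    define ys where "ys = take Z l"
    have ys: "distinct ys" "length ys = Z" "set ys \<subseteq> {..<N}"
      using l set_take_subset[of Z l] by (auto simp: ys_def strict_sorted_iff)
    have "c (place N ys s) = \<chi> (filter (\<lambda>a. a \<noteq> 3) s)"
      if s: "set s \<subseteq> {1, 2, 3}" "length s = Z" "length (filter (\<lambda>a. a \<noteq> 3) s) \<le> M" for s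
    proof -
      define w where "w = filter (\<lambda>a. a \<noteq> 3) s"
      define qs where "qs = filter (\<lambda>p. snd p \<noteq> 3) (zip ys s)"
      \<comment> \<open>The coordinates where \<open>s\<close> is not 3, topped up by spare ones to
        exactly \<open>M\<close>, the size of set to which \<open>hom\<close> applies.\<close>
      define ts where "ts = map fst qs @ take (M - length w) (drop Z l)"
      have "w \<in> W" using s by (auto simp: W_def w_def)
      have "map snd qs = w"
        using s(2) ys(2) unfolding qs_def w_def
        by (metis (no_types, lifting) comp_apply filter_cong filter_map map_snd_zip)
      then have lqs: "length qs = length w" by (metis length_map)
      have sub: "set (map fst qs) \<subseteq> set ys"
        by (auto simp: qs_def dest: set_zip_leftD)
      have sl: "sorted_wrt (<) (ys @ drop Z l)"
        using l by (simp add: ys_def)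
      have "sorted_wrt (<) (map fst (zip ys s))"
        using sl s(2) ys(2) by (simp add: sorted_wrt_append)
      then have "sorted_wrt (<) (map fst qs)"
        by (auto simp: qs_def sorted_wrt_map intro: sorted_wrt_filter)
      moreover have "sorted_wrt (<) (take (M - length w) (drop Z l))"
        using l by (simp)
      ultimately have sts: "sorted_wrt (<) ts"
        using sl sub set_take_subset[of "M - length w" "drop Z l"]
        unfolding ts_def sorted_wrt_append by blast
      \<comment> \<open>As \<open>ts\<close> is increasing, \<open>g (set ts)\<close> places words
        along \<open>ts\<close> itself, so \<open>w\<close> falls on the coordinates where
        \<open>s\<close> is not 3.\<close>
      then have lts: "sorted_list_of_set (set ts) = ts"
        by (simp add: sorted_list_of_set.idem_if_sorted_distinct strict_sorted_iff)
      have "length ts = M"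
        using lqs l s(3) by (simp add: ts_def w_def)
      moreover have "set ts \<subseteq> Y"
        using sub set_take_subset[of Z l] set_drop_subset[of Z l] l(2)
          set_take_subset[of "M - length w" "drop Z l"]
        unfolding ts_def ys_def by auto
      ultimately have "set ts \<in> nsets Y M"
        using sts by (auto simp: nsets_def distinct_card strict_sorted_iff)
      then have "g (set ts) w = \<chi> w"
        using hom by simp
      then have "c (place N ts w) = \<chi> w"
        using \<open>w \<in> W\<close> by (simp add: g_def lts)
      moreover have "place N ts w = place N ys s"
        unfolding ts_def qs_def w_def by (rule place_filter) (use ys s in auto)
      ultimately show ?thesis
        by (simp add: w_def)
    qed
    moreover have "\<chi> w \<in> {1, 2}" if "set w \<subseteq> {1, 2}" "length w \<le> M" for w
      using \<chi> that by (auto simp: W_def)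
    ultimately show "\<exists>ys \<chi>. distinct ys \<and> length ys = Z \<and> set ys \<subseteq> {..<N} \<and>
        (\<forall>w. set w \<subseteq> {1, 2} \<longrightarrow> length w \<le> M \<longrightarrow> \<chi> w \<in> {1, 2}) \<and>
        (\<forall>s. set s \<subseteq> {1, 2, 3} \<longrightarrow> length s = Z \<longrightarrow> length (filter (\<lambda>a. a \<noteq> 3) s) \<le> M \<longrightarrow>
           c (place N ys s) = \<chi> (filter (\<lambda>a. a \<noteq> 3) s))"
      using ys by blast
  qed
qed


section \<open>Monochromatic layers in word colourings\<close>

text \<open>When lengthening a run of \<open>k\<close> letters always switches between two colours,
  the middle letter of a block cannot affect the colour. The induction resets the middle letters to
  1 from the left, collecting finished blocks in \<open>p\<close>; the length bound keeps every word
  compared within reach of \<open>step\<close> and \<open>range\<close>.\<close>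

lemma concat_blocks_colour_const:
  fixes \<chi> :: "nat list \<Rightarrow> nat"
  assumes step: "\<And>a u v. a \<in> {1, 2} \<Longrightarrow> set u \<subseteq> {1, 2} \<Longrightarrow> set v \<subseteq> {1, 2} \<Longrightarrow>
      length u + Suc k + length v \<le> M \<Longrightarrow>
      \<chi> (u @ replicate k a @ v) \<noteq> \<chi> (u @ replicate (Suc k) a @ v)"
    and range: "\<And>w. set w \<subseteq> {1, 2} \<Longrightarrow> length w \<le> M \<Longrightarrow> \<chi> w \<in> {1, 2}"
    and "set p \<subseteq> {1, 2}" "set xs \<subseteq> {1, 2}" "length p + length xs * (2 * k + 1) \<le> M"
  defines "block \<equiv> \<lambda>x. replicate k 1 @ [x] @ replicate k 2"
  shows "\<chi> (p @ concat (map block xs)) = \<chi> (p @ concat (map block (replicate (length xs) 1)))"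
  using assms(3-5)
proof (induction xs arbitrary: p)
  case (Cons x xs)
  define q where "q = concat (map block xs)"
  have lenq: "length q = length xs * (2 * k + 1)"
    unfolding q_def by (induction xs) (auto simp: block_def)
  have setq: "set q \<subseteq> {1, 2}"
    using Cons.prems by (auto simp: q_def block_def)
  \<comment> \<open>The prefix grows by \<open>block 1\<close> rather than \<open>block x\<close>,
    so the right-hand side is already the word with all middle letters 1; \<open>flip\<close> then
    deals with the head.\<close>
  have IH: "\<chi> (p @ block 1 @ q) = \<chi> (p @ block 1 @ concat (map block (replicate (length xs) 1)))"
    using Cons.IH[of "p @ block 1"] Cons.prems by (simp add: q_def block_def set_replicate_conv_if)
  have flip: "\<chi> (p @ block 1 @ q) = \<chi> (p @ block 2 @ q)"
  proof -
    \<comment> \<open>Both words arise from \<open>w\<close> by lengthening a run of \<open>k\<close> letters, so both avoid its colour.\<close>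
    let ?w = "p @ replicate k 1 @ replicate k 2 @ q"
    have eqs: "p @ block 1 @ q = p @ replicate (Suc k) 1 @ (replicate k 2 @ q)"
      "p @ block 2 @ q = (p @ replicate k 1) @ replicate (Suc k) 2 @ q"
      by (simp_all add: block_def replicate_app_Cons_same)
    have "\<chi> ?w \<noteq> \<chi> (p @ block 1 @ q)"
      unfolding eqs using step[of 1 p "replicate k 2 @ q"] Cons.prems lenq setq
      by (auto simp: set_replicate_conv_if)
    moreover have "\<chi> ?w \<noteq> \<chi> (p @ block 2 @ q)"
      unfolding eqs using step[of 2 "p @ replicate k 1" q] Cons.prems lenq setq
      by (auto simp: set_replicate_conv_if)
    moreover have "\<chi> ?w \<in> {1, 2}" "\<chi> (p @ block 1 @ q) \<in> {1, 2}" "\<chi> (p @ block 2 @ q) \<in> {1, 2}"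
      using Cons.prems lenq setq by (intro range; auto simp: block_def set_replicate_conv_if)+
    ultimately show ?thesis by auto
  qed
  have "\<chi> (p @ block x @ q) = \<chi> (p @ block 1 @ q)"
    using flip Cons.prems by auto
  with IH show ?case
    by (simp add: q_def)
qed simp

lemma hypercube_coord: "x \<in> pverts (hypercube d) \<Longrightarrow> i < d \<Longrightarrow> x i \<in> {0, 1}"
  by (auto simp: hypercube_def hamming_graph_def PiE_iff)

text \<open>\<open>T\<close> codes cube vertices by words of one common length. Distances are
  preserved on the whole cube, while a single colour is claimed only on the edge layer, which is
  what the first case provides. \<open>M\<close> is the total length of the \<open>d\<close> blocks
  used in the second case.\<close>

lemma ex_monochromatic_layer_words:
  fixes \<chi> :: "nat list \<Rightarrow> nat"
  assumes "1 \<le> k"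
    and M: "M = d * (2 * k + 1)"
    and range: "\<forall>w. set w \<subseteq> {1, 2} \<longrightarrow> length w \<le> M \<longrightarrow> \<chi> w \<in> {1, 2}"
  shows "\<exists>T b. (\<forall>x \<in> pverts (hypercube d). set (T x) \<subseteq> {1, 2, 3} \<and> length (T x) = M + d) \<and>
    (\<forall>x \<in> pverts (hypercube d). \<forall>y \<in> pverts (hypercube d).
       list_dist (T x) (T y) = card {i \<in> {..<d}. x i \<noteq> y i}) \<and>
    (\<forall>x \<in> vertex_layer d k \<union> vertex_layer d (k - 1).
       length (filter (\<lambda>a. a \<noteq> 3) (T x)) \<le> M \<and> \<chi> (filter (\<lambda>a. a \<noteq> 3) (T x)) = b)"
proof (cases "\<exists>a\<in>{1, 2}. \<exists>u v. set u \<subseteq> {1, 2} \<and> set v \<subseteq> {1, 2} \<and>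
      length u + Suc k + length v \<le> M \<and>
      \<chi> (u @ replicate k a @ v) = \<chi> (u @ replicate (Suc k) a @ v)")
  case True
  then obtain a u v where a: "a \<in> {1, 2}" and u: "set u \<subseteq> {1, 2}" and v: "set v \<subseteq> {1, 2}"
    and len: "length u + Suc k + length v \<le> M"
    and eq: "\<chi> (u @ replicate k a @ v) = \<chi> (u @ replicate (Suc k) a @ v)"
    by blast
  \<comment> \<open>Coordinate 1 becomes \<open>a\<close> and 0 becomes 3, so erasing the 3s leaves
    a run whose length is the number of ones.\<close>
  define e where "e x = map (\<lambda>i. if x i = (1::nat) then a else 3) [0..<d]" for x
  define r where "r = M - (length u + 1 + length v)"
  \<comment> \<open>The fixed letter \<open>a\<close> turns the weights \<open>k - 1\<close> and
    \<open>k\<close> into runs of \<open>k\<close> and \<open>k + 1\<close> letters, the two lengths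
    compared in \<open>eq\<close>. The trailing 3s pad to length \<open>M + d\<close> and vanish on
    filtering.\<close>
  define T where "T x = u @ [a] @ e x @ v @ replicate r 3" for x
  have ne3: "filter (\<lambda>z. z \<noteq> 3) t = t" if "set t \<subseteq> {1, 2::nat}" for t
    using that by (intro filter_True) auto
  have filter_e: "filter (\<lambda>z. z \<noteq> 3) (e x) = replicate (card {i \<in> {..<d}. x i = 1}) a" for x
  proof -
    have "filter (\<lambda>z. z \<noteq> 3) (e x) = map (\<lambda>_. a) (filter (\<lambda>i. x i = 1) [0..<d])"
      using a unfolding e_def by (induction d) auto
    then show ?thesis
      by (simp add: map_replicate_const length_filter_upt)
  qed
  have filter_T: "filter (\<lambda>z. z \<noteq> 3) (T x) =
      u @ replicate (Suc (card {i \<in> {..<d}. x i = 1})) a @ v" for x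
    using a u v by (auto simp: T_def ne3 filter_e)
  have T_wf: "set (T x) \<subseteq> {1, 2, 3}" "length (T x) = M + d" for x
    using a u v len by (auto simp: T_def e_def r_def)
  have dist: "list_dist (T x) (T y) = card {i \<in> {..<d}. x i \<noteq> y i}"
    if "x \<in> pverts (hypercube d)" "y \<in> pverts (hypercube d)" for x y
  proof -
    have "list_dist (T x) (T y) = list_dist (e x) (e y)"
      by (simp add: T_def list_dist_append e_def del: append_Cons append_Nil)
    also have "\<dots> = card {i \<in> {..<d}. (if x i = 1 then a else 3) \<noteq> (if y i = 1 then a else 3)}"
      by (simp add: e_def list_dist_map length_filter_upt)
    also have "{i \<in> {..<d}. (if x i = 1 then a else 3) \<noteq> (if y i = 1 then a else 3)} =
        {i \<in> {..<d}. x i \<noteq> y i}"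
      using hypercube_coord[OF that(1)] hypercube_coord[OF that(2)] a by fastforce
    finally show ?thesis .
  qed
  have "length (filter (\<lambda>z. z \<noteq> 3) (T x)) \<le> M \<and> \<chi> (filter (\<lambda>z. z \<noteq> 3) (T x)) = \<chi> (u @ replicate k a @ v)"
    if "x \<in> vertex_layer d k \<union> vertex_layer d (k - 1)" for x
  proof -
    have "Suc (card {i \<in> {..<d}. x i = 1}) \<in> {k, Suc k}"
      using that \<open>1 \<le> k\<close> by (auto simp: vertex_layer_def)
    then show ?thesis
      using len eq unfolding filter_T by (elim insertE) auto
  qed
  with T_wf dist show ?thesis by blast
next
  case False
  define block where "block = (\<lambda>x::nat. replicate k 1 @ [x] @ replicate k 2)"
  \<comment> \<open>Coordinate \<open>i\<close> is stored in the middle letter of its own block,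
    with 0 and 1 renamed 1 and 2. The final 3s match the word length of the other case.\<close>
  define T where "T x = concat (map (\<lambda>i. block (x i + 1)) [0..<d]) @ replicate d 3" for x
  have len: "length (concat (map (\<lambda>i. block (x i + 1)) [0..<d])) = M" for x
    unfolding M by (induction d) (auto simp: block_def)
  have set: "set (concat (map (\<lambda>i. block (x i + 1)) [0..<d])) \<subseteq> {1, 2}"
    if "x \<in> pverts (hypercube d)" for x
    using hypercube_coord[OF that] by (fastforce simp: block_def)
  have T_wf: "set (T x) \<subseteq> {1, 2, 3}" "length (T x) = M + d" if "x \<in> pverts (hypercube d)" for x
    using set[OF that] len[of x] by (auto simp: T_def)
  have dist: "list_dist (T x) (T y) = card {i \<in> {..<d}. x i \<noteq> y i}" for x y
  proof -
    have "list_dist (T x) (T y) = (\<Sum>i\<leftarrow>[0..<d]. list_dist (block (x i + 1)) (block (y i + 1)))"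
      unfolding T_def using len[of x] len[of y]
      by (simp add: list_dist_append list_dist_concat_map block_def)
    \<comment> \<open>Two blocks agree outside their middle letters, so each coordinate contributes
      0 or 1.\<close>
    also have "\<dots> = (\<Sum>i\<leftarrow>[0..<d]. if x i \<noteq> y i then 1 else 0)"
      by (simp add: block_def list_dist_append del: append_Cons append_Nil)
        (simp add: list_dist_def if_distrib[of length] cong: if_cong)
    also have "\<dots> = length (filter (\<lambda>i. x i \<noteq> y i) [0..<d])"
      by (induction d) auto
    finally show ?thesis
      by (simp add: length_filter_upt)
  qed
  have filter_T: "filter (\<lambda>z. z \<noteq> 3) (T x) = concat (map (\<lambda>i. block (x i + 1)) [0..<d])"
    if "x \<in> pverts (hypercube d)" for x
  proof -
    have "filter (\<lambda>z. z \<noteq> 3) (concat (map (\<lambda>i. block (x i + 1)) [0..<d])) =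
        concat (map (\<lambda>i. block (x i + 1)) [0..<d])"
      by (rule filter_True) (use set[OF that] in auto)
    then show ?thesis
      by (simp add: T_def)
  qed
  \<comment> \<open>In this case the colour is constant on the whole cube, not only on two
    layers.\<close>
  have "\<chi> (filter (\<lambda>z. z \<noteq> 3) (T x)) = \<chi> (concat (map block (replicate d 1)))"
    if "x \<in> pverts (hypercube d)" for x
  proof -
    have xs: "set (map (\<lambda>i. x i + 1) [0..<d]) \<subseteq> {1, 2}"
      using hypercube_coord[OF that] by fastforce
    have step: "\<chi> (u @ replicate k a @ v) \<noteq> \<chi> (u @ replicate (Suc k) a @ v)"
      if "a \<in> {1, 2}" "set u \<subseteq> {1, 2}" "set v \<subseteq> {1, 2}" "length u + Suc k + length v \<le> M" for a u v
      using False that by blast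
    have "\<chi> (concat (map block (map (\<lambda>i. x i + 1) [0..<d]))) = \<chi> (concat (map block (replicate d 1)))"
      using concat_blocks_colour_const[where p = "[]" and k = k and M = M and \<chi> = \<chi>,
          OF step range[rule_format] _ xs]
      by (simp add: block_def M)
    then show ?thesis
      by (simp add: filter_T[OF that] comp_def)
  qed
  moreover have "x \<in> pverts (hypercube d)" if "x \<in> vertex_layer d k \<union> vertex_layer d (k - 1)" for x
    using that by (auto simp: vertex_layer_def)
  ultimately have "\<forall>x \<in> vertex_layer d k \<union> vertex_layer d (k - 1).
       length (filter (\<lambda>a. a \<noteq> 3) (T x)) \<le> M \<and>
       \<chi> (filter (\<lambda>a. a \<noteq> 3) (T x)) = \<chi> (concat (map block (replicate d 1)))"
    using filter_T len by simp
  with T_wf dist show ?thesis by blast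
qed


section \<open>Monochromatic copies in powers of the triangle\<close>

text \<open>\<open>F\<close> is the word code \<open>T\<close> followed by
  \<open>place N ys\<close>; both steps preserve Hamming distance, the second because the words have
  exactly the length of \<open>ys\<close>.\<close>

lemma ex_monochromatic_edge_layer:
  assumes "1 \<le> k"
  shows "\<exists>N. \<forall>c \<in> pverts (K3_power N) \<rightarrow> {1, 2::nat}. \<exists>F b.
    (\<forall>x \<in> pverts (hypercube d). F x \<in> pverts (K3_power N)) \<and>
    (\<forall>x \<in> pverts (hypercube d). \<forall>y \<in> pverts (hypercube d).
       card {j \<in> {..<N}. F x j \<noteq> F y j} = card {i \<in> {..<d}. x i \<noteq> y i}) \<and>
    (\<forall>x \<in> vertex_layer d k \<union> vertex_layer d (k - 1). c (F x) = b)"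
proof -
  define M where "M = d * (2 * k + 1)"
  obtain N where N: "\<forall>c \<in> pverts (K3_power N) \<rightarrow> {1, 2::nat}. \<exists>ys \<chi>.
    distinct ys \<and> length ys = M + d \<and> set ys \<subseteq> {..<N} \<and>
    (\<forall>w. set w \<subseteq> {1, 2} \<longrightarrow> length w \<le> M \<longrightarrow> \<chi> w \<in> {1, 2}) \<and>
    (\<forall>s. set s \<subseteq> {1, 2, 3} \<longrightarrow> length s = M + d \<longrightarrow> length (filter (\<lambda>a. a \<noteq> 3) s) \<le> M \<longrightarrow>
       c (place N ys s) = \<chi> (filter (\<lambda>a. a \<noteq> 3) s))"
    using ex_word_colouring[of "M + d" M] by (rule exE)
  show ?thesis
  proof (intro exI[of _ N] ballI)
    fix c assume "c \<in> pverts (K3_power N) \<rightarrow> {1, 2::nat}"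
    from bspec[OF N this] obtain ys \<chi> where
      ys: "distinct ys" "length ys = M + d" "set ys \<subseteq> {..<N}"
      and range: "\<forall>w. set w \<subseteq> {1, 2} \<longrightarrow> length w \<le> M \<longrightarrow> \<chi> w \<in> {1, 2}"
      and col: "\<And>s. set s \<subseteq> {1, 2, 3} \<Longrightarrow> length s = M + d \<Longrightarrow>
        length (filter (\<lambda>a. a \<noteq> 3) s) \<le> M \<Longrightarrow> c (place N ys s) = \<chi> (filter (\<lambda>a. a \<noteq> 3) s)"
      by blast
    from ex_monochromatic_layer_words[where \<chi> = \<chi>, OF assms M_def range] obtain T b where
      T [rule_format]: "\<forall>x \<in> pverts (hypercube d). set (T x) \<subseteq> {1, 2, 3} \<and> length (T x) = M + d"
      and dist [rule_format]: "\<forall>x \<in> pverts (hypercube d). \<forall>y \<in> pverts (hypercube d).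
        list_dist (T x) (T y) = card {i \<in> {..<d}. x i \<noteq> y i}"
      and mono [rule_format]: "\<forall>x \<in> vertex_layer d k \<union> vertex_layer d (k - 1).
        length (filter (\<lambda>a. a \<noteq> 3) (T x)) \<le> M \<and> \<chi> (filter (\<lambda>a. a \<noteq> 3) (T x)) = b"
      by (elim exE conjE)
    have "c (place N ys (T x)) = b" if "x \<in> vertex_layer d k \<union> vertex_layer d (k - 1)" for x
    proof -
      have "x \<in> pverts (hypercube d)"
        using that by (auto simp: vertex_layer_def)
      then show ?thesis
        using col[of "T x"] T mono[OF that] by simp
    qed
    moreover have place_dist: "card {j \<in> {..<N}. place N ys (T x) j \<noteq> place N ys (T y) j} =
        card {i \<in> {..<d}. x i \<noteq> y i}" if "x \<in> pverts (hypercube d)" "y \<in> pverts (hypercube d)" for x y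
      using card_place_diff[OF ys(1,3), of "T x" "T y"] T[OF that(1)] T[OF that(2)] ys(2) dist[OF that]
      by simp
    ultimately show "\<exists>F b. (\<forall>x \<in> pverts (hypercube d). F x \<in> pverts (K3_power N)) \<and>
      (\<forall>x \<in> pverts (hypercube d). \<forall>y \<in> pverts (hypercube d).
         card {j \<in> {..<N}. F x j \<noteq> F y j} = card {i \<in> {..<d}. x i \<noteq> y i}) \<and>
      (\<forall>x \<in> vertex_layer d k \<union> vertex_layer d (k - 1). c (F x) = b)"
      using T place_in_K3_power place_dist
      by (intro exI[of _ "\<lambda>x. place N ys (T x)"] exI[of _ b]) blast
  qed
qed

lemma parcs_hamming_graph_iff:
  assumes "x \<in> pverts (hamming_graph A n)" "y \<in> pverts (hamming_graph A n)"
  shows "(x, y) \<in> parcs (hamming_graph A n) \<longleftrightarrow> card {i \<in> {..<n}. x i \<noteq> y i} = 1"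
  using assms by (simp add: hamming_graph_def)

text \<open>Since \<open>F\<close> preserves distances, distance 0 gives injectivity and distance 1
  gives adjacency in both directions. The implication in the conclusion serves plain and induced
  copies at once.\<close>

lemma ex_monochromatic_copy:
  assumes "1 \<le> k" and copy: "copy_in H (edge_layer d k) S"
  shows "\<exists>N. \<forall>c \<in> pverts (K3_power N) \<rightarrow> {1, 2}. \<exists>S'.
    copy_in H (K3_power N) S' \<and> monochromatic c S' \<and>
    (induced_copy_in H (edge_layer d k) S \<longrightarrow> induced_copy_in H (K3_power N) S')"
proof -
  define V where "V = vertex_layer d k \<union> vertex_layer d (k - 1)"
  obtain N where N: "\<forall>c \<in> pverts (K3_power N) \<rightarrow> {1, 2::nat}. \<exists>F b.
    (\<forall>x \<in> pverts (hypercube d). F x \<in> pverts (K3_power N)) \<and>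
    (\<forall>x \<in> pverts (hypercube d). \<forall>y \<in> pverts (hypercube d).
       card {j \<in> {..<N}. F x j \<noteq> F y j} = card {i \<in> {..<d}. x i \<noteq> y i}) \<and>
    (\<forall>x \<in> V. c (F x) = b)"
    using ex_monochromatic_edge_layer[OF assms(1), of d] unfolding V_def by (rule exE)
  have V: "V \<subseteq> pverts (hypercube d)"
    by (auto simp: V_def vertex_layer_def)
  have layer: "verts (edge_layer d k) = V"
    "arcs (edge_layer d k) = {(x, y). (x, y) \<in> parcs (hypercube d) \<and> x \<in> V \<and> y \<in> V}"
    "tail (edge_layer d k) = fst" "head (edge_layer d k) = snd"
    using V unfolding edge_layer_def V_def[symmetric] by (auto simp: induce_subgraph_def)
  have wf: "pair_wf_digraph (K3_power N)"
  proof -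
    interpret pair_graph "K3_power N"
      unfolding K3_power_def by (rule pair_graph_hamming_graph) simp
    show ?thesis by unfold_locales
  qed
  show ?thesis
  proof (intro exI[of _ N] ballI)
    fix c assume "c \<in> pverts (K3_power N) \<rightarrow> {1, 2::nat}"
    from bspec[OF N this] obtain F b where
      F [rule_format]: "\<forall>x \<in> pverts (hypercube d). F x \<in> pverts (K3_power N)"
      and dist [rule_format]: "\<forall>x \<in> pverts (hypercube d). \<forall>y \<in> pverts (hypercube d).
         card {j \<in> {..<N}. F x j \<noteq> F y j} = card {i \<in> {..<d}. x i \<noteq> y i}"
      and mono [rule_format]: "\<forall>x \<in> V. c (F x) = b"
      by (elim exE conjE)
    have inj: "inj_on F V"
    proof (rule inj_onI)
      fix x y assume xy: "x \<in> V" "y \<in> V" "F x = F y"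
      then have "card {i \<in> {..<d}. x i \<noteq> y i} = 0"
        using dist[of x y] V by auto
      then have "\<forall>i\<in>{..<d}. x i = y i" by auto
      then show "x = y"
        using subsetD[OF V xy(1)] subsetD[OF V xy(2)] unfolding hypercube_def hamming_graph_def
        by (auto intro: PiE_ext)
    qed
    have arcs: "(x, y) \<in> parcs (hypercube d) \<longleftrightarrow> (F x, F y) \<in> parcs (K3_power N)"
      if "x \<in> V" "y \<in> V" for x y
    proof -
      have cube: "x \<in> pverts (hypercube d)" "y \<in> pverts (hypercube d)"
        using V that by auto
      show ?thesis
        using dist[OF cube] cube F[OF cube(1)] F[OF cube(2)]
        by (simp add: hypercube_def K3_power_def parcs_hamming_graph_iff)
    qed
    obtain S' where S': "copy_in H (K3_power N) S'" "verts S' = F ` verts S"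
        "induced_copy_in H (edge_layer d k) S \<longrightarrow> induced_copy_in H (K3_power N) S'"
    proof -
      have "\<exists>S'. copy_in H (K3_power N) S' \<and> verts S' = F ` verts S \<and>
          (induced_copy_in H (edge_layer d k) S \<longrightarrow> induced_copy_in H (K3_power N) S')"
      proof (rule copy_in_transport[OF wf layer(3,4) _ _ _ copy])
        show "F x \<in> pverts (K3_power N)" if "x \<in> verts (edge_layer d k)" for x
          using that F V layer(1) by auto
        show "inj_on F (verts (edge_layer d k))"
          using inj layer(1) by simp
        show "(x, y) \<in> arcs (edge_layer d k) \<longleftrightarrow> (F x, F y) \<in> parcs (K3_power N)"
          if "x \<in> verts (edge_layer d k)" "y \<in> verts (edge_layer d k)" for x y
          using that arcs[of x y] layer(1,2) by simp
      qed
      then show ?thesis using that by blast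
    qed
    moreover have "verts S \<subseteq> V"
      using copy layer by (auto simp: copy_in_def subgraph_def)
    then have "monochromatic c S'"
      using mono S'(2) by (auto simp: monochromatic_def intro!: exI[of _ b])
    ultimately show "\<exists>S'. copy_in H (K3_power N) S' \<and> monochromatic c S' \<and>
        (induced_copy_in H (edge_layer d k) S \<longrightarrow> induced_copy_in H (K3_power N) S')"
      by blast
  qed
qed

theorem theorem1p4:
  fixes H :: "('a, 'b) pre_digraph"
  assumes "graph H"
  shows "(layered H \<longrightarrow>
            (\<exists>N. \<forall>c \<in> pverts (K3_power N) \<rightarrow> {1, 2}.
               \<exists>S. copy_in H (K3_power N) S \<and> monochromatic c S))
       \<and> (induced_layered H \<longrightarrow>
            (\<exists>N. \<forall>c \<in> pverts (K3_power N) \<rightarrow> {1, 2}.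
               \<exists>S. induced_copy_in H (K3_power N) S \<and> monochromatic c S))"
proof (intro conjI impI)
  assume "layered H"
  then obtain d k S where "1 \<le> k" "copy_in H (edge_layer d k) S"
    by (auto simp: layered_def)
  from ex_monochromatic_copy[OF this]
  show "\<exists>N. \<forall>c \<in> pverts (K3_power N) \<rightarrow> {1, 2}. \<exists>S. copy_in H (K3_power N) S \<and> monochromatic c S"
    by blast
next
  assume "induced_layered H"
  then obtain d k S where k: "1 \<le> k" and S: "induced_copy_in H (edge_layer d k) S"
    by (auto simp: induced_layered_def)
  \<comment> \<open>An induced copy is first treated as a plain one; the assumption on
    \<open>S\<close> then discharges the implication in
    \<open>ex_monochromatic_copy\<close>.\<close>
  then have "copy_in H (edge_layer d k) S"
    by (auto simp: induced_copy_in_def copy_in_def induced_subgraph_def)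
  from ex_monochromatic_copy[OF k this] S
  show "\<exists>N. \<forall>c \<in> pverts (K3_power N) \<rightarrow> {1, 2}.
      \<exists>S. induced_copy_in H (K3_power N) S \<and> monochromatic c S"
    by blast
qed

end
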